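(* Let $U=[0,1]^2$ and let $S\subset U$ be any finite set of points with $(0,0)\in S$. Then the GreedyPacking algorithm (with the processing order defined in the context) outputs a lower-left anchored rectangle packing $R$ of $S$ whose total covered area satisfies $\mathrm{area}(R)\ge 0.10390$.
   Context: For a point $p$, $x(p)$ and $y(p)$ denote its coordinates. A rectangle is lower-left anchored at $p$ if it is an axis-parallel rectangle with lower-left corner $p$ (a point or segment counts as a degenerate rectangle of area $0$). A lower-left anchored rectangle packing (LLARP) of $S$ is a set of axis-parallel rectangles contained in $U$, pairwise interior-disjoint, one rectangle lower-left anchored at each point of $S$, none containing a point of $S$ in its interior. The GreedyPacking algorithm: fix a total order of $S$ in which $p$ comes before $q$ whenever $x(p)+y(p)>x(q)+y(q)$ (ties broken arbitrarily but consistently). Start with $R=\emptyset$; process the points of $S$ in this order (largest coordinate sum first), and for the current point $p$ add to $R$ a maximum-area rectangle contained in $U$, lower-left anchored at $p$, interior-disjoint from all rectangles already in $R$ and containing no point of $S$ in its interior. Return $R$. $\mathrm{area}(R)$ is the area of the union of the rectangles in $R$. *)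

theory Defs
  imports "HOL-Analysis.Analysis"
begin

type_synonym point = "real \<times> real"

definition unit_sq :: "point set" where
  "unit_sq = {0..1} \<times> {0..1}"

definition csum :: "point \<Rightarrow> real" where
  "csum p = fst p + snd p"

definition ll_rect :: "point \<Rightarrow> real \<times> real \<Rightarrow> point set" where
  "ll_rect p d = {fst p .. fst p + fst d} \<times> {snd p .. snd p + snd d}"

definition feasible_rect :: "point set \<Rightarrow> point set set \<Rightarrow> point \<Rightarrow> real \<times> real \<Rightarrow> bool" where
  "feasible_rect S placed p d \<longleftrightarrow>
     0 \<le> fst d \<and> 0 \<le> snd d \<and> ll_rect p d \<subseteq> unit_sq \<and>
     (\<forall>R\<in>placed. interior (ll_rect p d) \<inter> interior R = {}) \<and>
     (\<forall>q\<in>S. q \<notin> interior (ll_rect p d))"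

definition is_LLARP :: "point set \<Rightarrow> (point \<Rightarrow> real \<times> real) \<Rightarrow> bool" where
  "is_LLARP S D \<longleftrightarrow>
     (\<forall>p\<in>S. 0 \<le> fst (D p) \<and> 0 \<le> snd (D p) \<and> ll_rect p (D p) \<subseteq> unit_sq \<and>
             (\<forall>q\<in>S. q \<notin> interior (ll_rect p (D p)))) \<and>
     (\<forall>p\<in>S. \<forall>q\<in>S. p \<noteq> q \<longrightarrow>
             interior (ll_rect p (D p)) \<inter> interior (ll_rect q (D q)) = {})"

definition greedy_order :: "point set \<Rightarrow> point list \<Rightarrow> bool" where
  "greedy_order S ps \<longleftrightarrow> distinct ps \<and> set ps = S \<and>
     (\<forall>i j. i < j \<and> j < length ps \<longrightarrow> csum (ps ! j) \<le> csum (ps ! i))"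

definition greedy_run :: "point set \<Rightarrow> point list \<Rightarrow> (point \<Rightarrow> real \<times> real) \<Rightarrow> bool" where
  "greedy_run S ps D \<longleftrightarrow> greedy_order S ps \<and>
     (\<forall>i < length ps.
        let p = ps ! i; placed = {ll_rect (ps ! j) (D (ps ! j)) | j. j < i} in
        feasible_rect S placed p (D p) \<and>
        (\<forall>d. feasible_rect S placed p d \<longrightarrow> fst d * snd d \<le> fst (D p) * snd (D p)))"

definition packing_area :: "point set \<Rightarrow> (point \<Rightarrow> real \<times> real) \<Rightarrow> real" where
  "packing_area S D = measure lborel (\<Union>p\<in>S. ll_rect p (D p))"

end

(* Let the tile of a point p be the part of the quadrant at p, cut to the unit square, outside the
quadrants of all points processed before p. The tiles cover the square, and the rectangle chosen for
p has area r at least that of any rectangle anchored at p inside its tile; hence, in coordinates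
centred at p, the tile lies under the hyperbola x y = r. Cut the tile into the parts y < x/16,
x < y/16 and the rest; the rest is covered by five rectangles of area r. Below the bottom side of
the tile lies a "skirt": points z such that the height of the tile drops between the
abscissa at which the antidiagonal through z meets the bottom side and the abscissa of z. A shear
that stretches by 16 sends a point (x, y) of the part y < x/16 into the skirt unless the height of
the tile is constant on [16 y, x], and the points of the latter kind all lie in a common rectangle
of area r. Processing by decreasing coordinate sum makes the skirts of different points disjoint,
and they all lie in a rectangle of area 2. Summing over p, with the symmetric skirts to the left:
1 <= 7 * (sum of r) + (2 + 2) / 16, so the packing covers at least 3/28 > 0.107. *)

theory Submission
  imports Defs
begin

section \<open>Tiles, skirts and disjointness of skirts\<close>

text \<open>\<open>B\<close> stands for the points processed before \<open>p\<close>. The removed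
  quadrants are open, so \<open>z\<close> belongs to the tile exactly when the rectangle with
  corners \<open>p\<close> and \<open>z\<close> is nondegenerate, stays below and left of
  \<open>(1, 1)\<close>, and has interior disjoint from all of them.\<close>

definition tile :: "point set \<Rightarrow> point \<Rightarrow> point set" where
  "tile B p = {z. fst p < fst z \<and> fst z \<le> 1 \<and> snd p < snd z \<and> snd z \<le> 1 \<and>
     (\<forall>q\<in>B. \<not> (fst q < fst z \<and> snd q < snd z))}"

text \<open>The antidiagonal through \<open>z\<close> meets the line of the bottom side at abscissa
  \<open>csum z - snd p\<close>. The first quantifier says that the bottom side still reaches
  \<open>fst z\<close>. The witness \<open>s\<close> records a drop of the height: it is lower than
  every point of \<open>B\<close> left of that abscissa, which avoids minima over possibly empty
  sets. The bounds on \<open>fst s\<close> force \<open>snd z < snd p\<close>.\<close>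

definition skirt :: "point set \<Rightarrow> point \<Rightarrow> point set" where
  "skirt B p = {z. csum p < csum z \<and> fst z \<le> 1 \<and> (\<forall>q\<in>B. fst q < fst z \<longrightarrow> snd p < snd q) \<and>
     (\<exists>s\<in>B. csum z - snd p \<le> fst s \<and> fst s < fst z \<and>
        (\<forall>q\<in>B. fst q < csum z - snd p \<longrightarrow> snd s < snd q))}"

lemma interior_ll_rect:
  "interior (ll_rect p d) =
     {fst p <..< fst p + fst d} \<times> {snd p <..< snd p + snd d}"
  by (simp add: ll_rect_def interior_Times)

text \<open>Here \<open>q\<close> precedes \<open>p\<close>. For a common point \<open>z\<close>,
  the drop \<open>s\<close> seen from \<open>p\<close> would be lower than \<open>q\<close>, because
  \<open>q\<close> lies left of the antidiagonal's foot. But \<open>s\<close> has a larger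
  coordinate sum than \<open>q\<close>, so it also belongs to \<open>B'\<close>, and the skirt of
  \<open>q\<close> requires it to be higher than \<open>q\<close>.\<close>

lemma skirt_disjoint:
  assumes "q \<in> B" "\<And>s. s \<in> B \<Longrightarrow> csum q < csum s \<Longrightarrow> s \<in> B'"
  shows "skirt B p \<inter> skirt B' q = {}"
proof -
  have False if z: "z \<in> skirt B p" "z \<in> skirt B' q" for z
  proof -
    obtain s where s: "s \<in> B" "csum z - snd p \<le> fst s" "fst s < fst z"
      "\<And>q. q \<in> B \<Longrightarrow> fst q < csum z - snd p \<Longrightarrow> snd s < snd q"
      using z(1) unfolding skirt_def by blast
    have qz: "csum q < csum z" "fst q < fst z"
      using z(2) unfolding skirt_def csum_def by auto
    have pq: "snd p < snd q" and ps: "snd p < snd s"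
      using z(1) assms(1) qz(2) s(1,3) unfolding skirt_def by auto
    have "snd s < snd q"
      using s(4)[OF assms(1)] qz(1) pq unfolding csum_def by auto
    moreover have "csum q < csum s"
      using qz(1) s(2) ps unfolding csum_def by linarith
    then have "s \<in> B'" using assms(2) s(1) by blast
    then have "snd q < snd s" using z(2) s(3) unfolding skirt_def by auto
    ultimately show False by simp
  qed
  then show ?thesis by blast
qed

lemma skirt_subset: "skirt B p \<subseteq> {fst p..1} \<times> {csum p - 1..snd p}"
  unfolding skirt_def csum_def by auto

section \<open>Measurability, shears and reflection\<close>

lemma skirt_borel [measurable]: "finite B \<Longrightarrow> skirt B p \<in> sets borel"
proof -
  assume [simp]: "finite B"
  have [measurable]: "(fst :: point \<Rightarrow> real) \<in> borel_measurable borel" "(snd :: point \<Rightarrow> real) \<in> borel_measurable borel"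
    by (auto intro!: borel_measurable_continuous_onI continuous_intros)
  have [measurable]: "countable B" by (simp add: countable_finite)
  show ?thesis unfolding skirt_def csum_def
    by measurable
qed

lemma tile_borel [measurable]: "finite B \<Longrightarrow> tile B p \<in> sets borel"
proof -
  assume [simp]: "finite B"
  have [measurable]: "(fst :: point \<Rightarrow> real) \<in> borel_measurable borel" "(snd :: point \<Rightarrow> real) \<in> borel_measurable borel"
    by (auto intro!: borel_measurable_continuous_onI continuous_intros)
  have [measurable]: "countable B" by (simp add: countable_finite)
  show ?thesis unfolding tile_def
    by measurable
qed

lemma emeasure_lborel_vimage_affine:
  fixes X :: "real set"
  assumes [measurable]: "X \<in> sets borel" and "c > 0"
  shows "emeasure lborel X = ennreal c * emeasure lborel ((\<lambda>x. t + c * x) -` X)"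
proof -
  have "emeasure lborel X = emeasure (density (distr lborel borel (\<lambda>x. t + c * x)) (\<lambda>_. ennreal \<bar>c\<bar>)) X"
    using lborel_real_affine[of c t] assms(2) by simp
  also have "\<dots> = ennreal c * emeasure lborel ((\<lambda>x. t + c * x) -` X)"
    using assms(2) by (simp add: emeasure_density_const emeasure_distr)
  finally show ?thesis .
qed

text \<open>On each vertical line \<open>\<phi>\<close> is affine with slope \<open>c\<close>, so
  the one-dimensional scaling law integrates over abscissas.\<close>

lemma emeasure_lborel_vimage_shear:
  fixes A :: "point set"
    and t c :: real
  assumes [measurable]: "A \<in> sets borel" and c: "c > 0"
  defines "\<phi> \<equiv> \<lambda>z :: point. (fst z, t - fst z + c * snd z)"
  shows "emeasure lborel A = ennreal c * emeasure lborel (\<phi> -` A)" "\<phi> -` A \<in> sets borel"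
proof -
  have "continuous_on UNIV \<phi>" unfolding \<phi>_def by (intro continuous_intros)
  then have \<phi>[measurable]: "\<phi> \<in> borel_measurable borel" by (rule borel_measurable_continuous_onI)
  show [measurable]: "\<phi> -` A \<in> sets borel" using measurable_sets_borel[OF \<phi> assms(1)] by simp
  have p: "emeasure lborel X = (\<integral>\<^sup>+x. emeasure lborel (Pair x -` X) \<partial>lborel)"
    if "X \<in> sets borel" for X :: "point set"
    using lborel.emeasure_pair_measure_alt[of X lborel] that by (simp add: lborel_prod flip: borel_prod)
  have m: "Pair x -` X \<in> sets borel" if "X \<in> sets borel" for x and X :: "point set"
    using sets_Pair1[of X lborel lborel x] that by (simp add: lborel_prod flip: borel_prod)
  have "emeasure lborel A = (\<integral>\<^sup>+x. ennreal c * emeasure lborel (Pair x -` \<phi> -` A) \<partial>lborel)"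
    unfolding p[OF assms(1)]
  proof (rule nn_integral_cong)
    fix x
    show "emeasure lborel (Pair x -` A) = ennreal c * emeasure lborel (Pair x -` \<phi> -` A)"
      unfolding emeasure_lborel_vimage_affine[OF m[OF assms(1)] c, of x "t - x"]
      by (simp add: \<phi>_def vimage_def)
  qed
  also have "\<dots> = ennreal c * emeasure lborel (\<phi> -` A)"
    unfolding p[OF \<open>\<phi> -` A \<in> sets borel\<close>]
    by (rule nn_integral_cmult)
       (use lborel.measurable_emeasure_Pair[of "\<phi> -` A" lborel] \<open>\<phi> -` A \<in> sets borel\<close> in \<open>simp add: lborel_prod flip: borel_prod\<close>)
  finally show "emeasure lborel A = ennreal c * emeasure lborel (\<phi> -` A)" .
qed

lemma lborel_swap:
  fixes A :: "point set"
  assumes "A \<in> sets borel"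
  shows "prod.swap ` A \<in> sets borel" "emeasure lborel (prod.swap ` A) = emeasure lborel A"
proof -
  have s: "prod.swap ` A = prod.swap -` A" by (force simp: image_iff)
  have "continuous_on UNIV (prod.swap :: point \<Rightarrow> point)" unfolding prod.swap_def by (intro continuous_intros)
  then have m: "(prod.swap :: point \<Rightarrow> point) \<in> borel_measurable borel" by (rule borel_measurable_continuous_onI)
  show "prod.swap ` A \<in> sets borel" unfolding s using measurable_sets_borel[OF m assms] by simp
  have "(lborel :: point measure) = distr lborel borel prod.swap"
  proof -
    have "(prod.swap :: point \<Rightarrow> point) = (\<lambda>(x, y). (y, x))" by auto
    moreover have "(lborel :: point measure) = distr lborel lborel (\<lambda>(x, y). (y, x))"
      using lborel_pair.distr_pair_swap[where ?'a=real and ?'b=real] by (simp only: lborel_prod)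
    ultimately show ?thesis by (simp cong: distr_cong)
  qed
  then have "emeasure lborel A = emeasure (distr lborel borel prod.swap) A" by simp
  also have "\<dots> = emeasure lborel (prod.swap ` A)"
    unfolding s using assms m by (subst emeasure_distr) auto
  finally show "emeasure lborel (prod.swap ` A) = emeasure lborel A" ..
qed

lemma tile_swap: "z \<in> tile (prod.swap ` B) (prod.swap p) \<longleftrightarrow> prod.swap z \<in> tile B p"
  unfolding tile_def by auto


section \<open>Boxes in the plane and covers by one box\<close>

lemma cbox_point: "cbox a b = {fst a..fst b} \<times> {snd a..snd b}" for a b :: point
  by (cases a; cases b) (simp add: cbox_Pair_eq)

lemma box_point: "box a b = {fst a<..<fst b} \<times> {snd a<..<snd b}" for a b :: point
  by (cases a; cases b) (auto simp: box_def Basis_prod_def)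

lemma measure_cbox_point:
  "measure lborel (cbox a b) = (fst b - fst a) * (snd b - snd a)"
  if "fst a \<le> fst b" "snd a \<le> snd b" for a b :: point
  using that by (cases a; cases b) (simp add: content_Pair)

lemma measure_box_point:
  "measure lborel (box a b) = (fst b - fst a) * (snd b - snd a)"
  if "fst a \<le> fst b" "snd a \<le> snd b" for a b :: point
  using measure_cbox_point[OF that]
  by (simp add: measure_lborel_box_eq measure_lborel_cbox_eq del: measure_lborel_cbox measure_lborel_box)

lemma in_set_take_iff: "i \<le> length xs \<Longrightarrow> x \<in> set (take i xs) \<longleftrightarrow> (\<exists>j<i. x = xs ! j)"
  by (auto simp: in_set_conv_nth min_def)

text \<open>The hypothesis on pairs bounds every rectangle spanned by the abscissa of one point and the
  ordinate of another, hence the bounding box.\<close>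
lemma directed_cover:
  fixes N :: "point set"
  assumes "0 \<le> r" and pos: "\<And>z. z \<in> N \<Longrightarrow> fst p < fst z \<and> snd p < snd z"
    and prod: "\<And>z z'. z \<in> N \<Longrightarrow> z' \<in> N \<Longrightarrow> (fst z - fst p) * (snd z' - snd p) \<le> r"
  obtains K where "K \<in> fmeasurable lborel" "N \<subseteq> K" "measure lborel K \<le> r"
proof (cases "N = {}")
  case True
  then show ?thesis using that[of "{}"] \<open>0 \<le> r\<close> by simp
next
  case False
  define X where "X = (SUP z\<in>N. fst z)"
  define Y where "Y = (SUP z\<in>N. snd z)"
  obtain w where w: "w \<in> N" using False by blast
  \<comment> \<open>Dividing by one height separates the two points, so the suprema can be taken one
    coordinate at a time, first \<open>X\<close> and then \<open>Y\<close>.\<close>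
  have Xb: "fst z \<le> fst p + r / (snd w' - snd p)" if "z \<in> N" "w' \<in> N" for z w'
    using prod[OF that] pos[OF that(2)] by (simp add: field_simps)
  have X: "fst z \<le> X" if "z \<in> N" for z
    unfolding X_def using that Xb[OF _ w] by (intro cSUP_upper bdd_aboveI2) auto
  have Xp: "fst p < X" using X[OF w] pos[OF w] by simp
  have Xle: "X \<le> fst p + r / (snd w' - snd p)" if "w' \<in> N" for w'
    unfolding X_def using Xb[OF _ that] False by (intro cSUP_least) auto
  have Yb: "snd z \<le> snd p + r / (X - fst p)" if "z \<in> N" for z
    using Xle[OF that] pos[OF that] Xp by (simp add: field_simps)
  have Y: "snd z \<le> Y" if "z \<in> N" for z
    unfolding Y_def using that Yb by (intro cSUP_upper bdd_aboveI2) auto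
  have Yp: "snd p < Y" using Y[OF w] pos[OF w] by simp
  have "Y \<le> snd p + r / (X - fst p)"
    unfolding Y_def using Yb False by (intro cSUP_least) auto
  then have "(X - fst p) * (Y - snd p) \<le> r" using Xp by (simp add: field_simps)
  then have "measure lborel (cbox p (X, Y)) \<le> r"
    using Xp Yp by (simp add: measure_cbox_point del: measure_lborel_cbox)
  moreover have "N \<subseteq> cbox p (X, Y)"
  proof
    fix z assume "z \<in> N"
    then show "z \<in> cbox p (X, Y)"
      using X Y pos by (auto simp: cbox_point mem_Times_iff less_imp_le)
  qed
  ultimately show ?thesis using that[of "cbox p (X, Y)"] by (simp add: fmeasurable_cbox)
qed

section \<open>Area of one tile\<close>

lemma skirt_fmeasurable: "finite B \<Longrightarrow> skirt B p \<in> fmeasurable lborel"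
  using skirt_subset[of B p]
  by (intro fmeasurableI2[OF fmeasurable_compact[OF compact_Times[OF compact_Icc compact_Icc]]]) auto

text \<open>The preimage \<open>C\<close> of the skirt under the shear costs a sixteenth of the
  skirt. The remaining points \<open>N\<close> satisfy the pairwise bound of
  \<open>directed_cover\<close> and so fit into one box of area at most \<open>r\<close>.\<close>

lemma flat_half_tile_cover:
  assumes "finite B" "0 \<le> r"
    and hyp: "\<And>z. z \<in> tile B p \<Longrightarrow> (fst z - fst p) * (snd z - snd p) \<le> r"
  obtains K where "K \<in> fmeasurable lborel"
    "{z \<in> tile B p. 16 * (snd z - snd p) < fst z - fst p} \<subseteq> K"
    "measure lborel K \<le> r + measure lborel (skirt B p) / 16"
proof -
  \<comment> \<open>With \<open>p\<close> as origin, \<open>\<phi> (x, y) = (x, 16 y - x)\<close>: its antidiagonal meets the bottom side at \<open>16 y\<close>.\<close>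
  define \<phi> where "\<phi> = (\<lambda>z :: point. (fst z, (fst p - 15 * snd p) - fst z + 16 * snd z))"
  define C where "C = \<phi> -` skirt B p"
  define N where "N = {z \<in> tile B p - C. 16 * (snd z - snd p) < fst z - fst p}"
  note shear = emeasure_lborel_vimage_shear[OF skirt_borel[OF assms(1), of p], of 16 "fst p - 15 * snd p",
      folded \<phi>_def C_def]
  have csum: "csum (\<phi> z) - snd p = fst p + 16 * (snd z - snd p)" for z
    unfolding \<phi>_def csum_def by simp
  have C: "C \<in> fmeasurable lborel" "measure lborel C = measure lborel (skirt B p) / 16"
  proof -
    have e: "emeasure lborel (skirt B p) = 16 * emeasure lborel C" using shear(1) by simp
    have "emeasure lborel (skirt B p) < \<infinity>"
      using skirt_fmeasurable[OF assms(1), of p] by (simp add: fmeasurable_def)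
    then have "emeasure lborel C < \<infinity>" unfolding e by (auto simp: ennreal_mult_less_top)
    then show "C \<in> fmeasurable lborel" using shear(2) by (simp add: fmeasurable_def)
    show "measure lborel C = measure lborel (skirt B p) / 16"
      unfolding measure_def e by (simp add: enn2real_mult)
  qed
  have prod: "(fst z' - fst p) * (snd z - snd p) \<le> r" if z: "z \<in> N" "z' \<in> N" for z z'
  proof -
    have pos: "fst p < fst z" "fst p < fst z'" "snd p < snd z" "snd p < snd z'"
      using z unfolding N_def tile_def by auto
    have t: "z \<in> tile B p" "z' \<in> tile B p" "z' \<notin> C" using z unfolding N_def by auto
    consider "fst z' \<le> fst z" | "snd z \<le> snd z'" | "fst z < fst z'" "snd z' < snd z" by linarith
    then show ?thesis
    proof cases
      case 1
      then show ?thesis using hyp[OF t(1)] pos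
        by (meson diff_right_mono less_imp_le mult_right_mono diff_ge_0_iff_ge order_trans)
    next
      case 2
      then show ?thesis using hyp[OF t(2)] pos
        by (meson diff_right_mono less_imp_le mult_left_mono diff_ge_0_iff_ge order_trans)
    next
      case 3
      \<comment> \<open>Only this case is not a direct consequence of \<open>hyp\<close> at
        \<open>z\<close> or \<open>z'\<close>. As \<open>z\<close> lies in the flat part and above
        \<open>z'\<close>, the abscissa \<open>?X\<close> is left of \<open>z\<close>.\<close>
      let ?X = "csum (\<phi> z') - snd p"
      have X: "?X < fst z" using z(1) 3 unfolding N_def csum by simp
      \<comment> \<open>Otherwise \<open>s\<close> would witness a drop between \<open>?X\<close>
        and \<open>fst z'\<close>, putting \<open>\<phi> z'\<close> into the skirt and
        \<open>z'\<close> into \<open>C\<close>.\<close>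
      have ns: "\<exists>q\<in>B. fst q < ?X \<and> snd q \<le> snd s" if s: "s \<in> B" "?X \<le> fst s" "fst s < fst z'" for s
      proof (rule ccontr)
        assume "\<not> ?thesis"
        then have "\<forall>q\<in>B. fst q < csum (\<phi> z') - snd p \<longrightarrow> snd s < snd q" by auto
        moreover have "csum p < csum (\<phi> z')" using csum[of z'] pos(4) by (simp add: csum_def[of p])
        moreover have "\<forall>q\<in>B. fst q < fst z' \<longrightarrow> snd p < snd q" "fst z' \<le> 1"
          using t(2) pos unfolding tile_def by force+
        ultimately have "\<phi> z' \<in> skirt B p"
          using s unfolding skirt_def by (auto simp: \<phi>_def)
        then show False using t(3) unfolding C_def by simp
      qed
      \<comment> \<open>Without a drop, the tile is as high at \<open>fst z'\<close> as at
        \<open>?X\<close>, hence at least as high as at \<open>fst z\<close>. So the corner lies in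
        the tile and \<open>hyp\<close> bounds the product.\<close>
      have "(fst z', snd z) \<in> tile B p"
      proof -
        have "\<not> (fst s < fst z' \<and> snd s < snd z)" if "s \<in> B" for s
        proof
          assume s: "fst s < fst z' \<and> snd s < snd z"
          then have "fst z \<le> fst s" using t(1) that unfolding tile_def by force
          then obtain q where "q \<in> B" "fst q < ?X" "snd q \<le> snd s"
            using ns[OF \<open>s \<in> B\<close>] s X by fastforce
          then show False using t(1) X s unfolding tile_def by force
        qed
        then show ?thesis using t pos unfolding tile_def by auto
      qed
      then show ?thesis using hyp by fastforce
    qed
  qed
  obtain K where K: "K \<in> fmeasurable lborel" "N \<subseteq> K" "measure lborel K \<le> r"
  proof (rule directed_cover[of r N p])
    show "fst p < fst z \<and> snd p < snd z" if "z \<in> N" for z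
      using that unfolding N_def tile_def by auto
  qed (use prod assms(2) in auto)
  show ?thesis
  proof (rule that[of "K \<union> C"])
    show "K \<union> C \<in> fmeasurable lborel" using K C by (simp add: fmeasurable.Un)
    show "{z \<in> tile B p. 16 * (snd z - snd p) < fst z - fst p} \<subseteq> K \<union> C"
      using K(2) unfolding N_def by blast
    show "measure lborel (K \<union> C) \<le> r + measure lborel (skirt B p) / 16"
      using measure_Un_le[of K lborel C] K C by (auto simp: fmeasurable_def)
  qed
qed

text \<open>The flat part and, by reflection, the steep part each cost \<open>r\<close> plus a
  sixteenth of a skirt; the middle part costs five boxes of area \<open>r\<close>, whence the factor
  7.\<close>

lemma measure_tile_le:
  assumes "finite B" "0 \<le> r"
    and hyp: "\<And>z. z \<in> tile B p \<Longrightarrow> (fst z - fst p) * (snd z - snd p) \<le> r"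
  shows "measure lborel (tile B p) \<le>
    7 * r + (measure lborel (skirt B p) + measure lborel (skirt (prod.swap ` B) (prod.swap p))) / 16"
proof -
  obtain K where K: "K \<in> fmeasurable lborel"
    "{z \<in> tile B p. 16 * (snd z - snd p) < fst z - fst p} \<subseteq> K"
    "measure lborel K \<le> r + measure lborel (skirt B p) / 16"
    using flat_half_tile_cover[OF assms(1,2), of p] hyp by blast
  obtain L where L: "L \<in> fmeasurable lborel"
    "{z \<in> tile (prod.swap ` B) (prod.swap p). 16 * (fst (prod.swap z) - fst p) < snd (prod.swap z) - snd p} \<subseteq> L"
    "measure lborel L \<le> r + measure lborel (skirt (prod.swap ` B) (prod.swap p)) / 16"
  proof (rule flat_half_tile_cover[of "prod.swap ` B" r "prod.swap p"])
    show "(fst z - fst (prod.swap p)) * (snd z - snd (prod.swap p)) \<le> r"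
      if "z \<in> tile (prod.swap ` B) (prod.swap p)" for z
      using hyp[of "prod.swap z"] that by (simp add: tile_swap mult.commute)
  qed (use assms in auto)
  define s where "s = sqrt r"
  have s: "0 \<le> s" "s * s = r" using assms(2) unfolding s_def by auto
  define box where "box = (\<lambda>a b c d. cbox (fst p + a, snd p + b) (fst p + c, snd p + d))"
  have box: "measure lborel (box a b c d) = (c - a) * (d - b)" if "a \<le> c" "b \<le> d" for a b c d
    unfolding box_def using that by (simp add: content_Pair)
  \<comment> \<open>With \<open>s\<close> the square root of \<open>r\<close>, the hyperbola is
    covered in dyadic steps: two unit steps of \<open>s\<close> by \<open>s\<close> boxes, then one
    box of size \<open>2 * s\<close> by \<open>s / 2\<close>, mirrored in the diagonal.\<close>
  let ?Q = "box 0 0 s s \<union> box s 0 (2 * s) s \<union> box (2 * s) 0 (4 * s) (s/2) \<union> box 0 s s (2 * s) \<union> box 0 (2 * s) (s/2) (4 * s)"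
  have bs: "box a b c d \<in> fmeasurable lborel" for a b c d unfolding box_def by (rule fmeasurable_cbox)
  note bs' = fmeasurableD[OF bs]
  have "measure lborel ?Q \<le> r + r + r + r + r"
    by (intro order_trans[OF measure_Un_le] add_mono sets.Un bs')
       (use s in \<open>simp_all add: box\<close>)
  have sub: "tile B p \<subseteq> K \<union> prod.swap ` L \<union> ?Q"
  proof
    fix z assume z: "z \<in> tile B p"
    define x where "x = fst z - fst p"
    define y where "y = snd z - snd p"
    have zx: "z = (fst p + x, snd p + y)" unfolding x_def y_def by simp
    have mem: "z \<in> box a b c d \<longleftrightarrow> a \<le> x \<and> x \<le> c \<and> b \<le> y \<and> y \<le> d" for a b c d
      unfolding box_def zx cbox_point by auto
    have xy: "0 < x" "0 < y" "x * y \<le> s * s"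
      using z hyp[OF z] s unfolding x_def y_def tile_def by auto
    consider "16 * y < x" | "16 * x < y" | "x \<le> 16 * y" "y \<le> 16 * x" by linarith
    then show "z \<in> K \<union> prod.swap ` L \<union> ?Q"
    proof cases
      case 1
      then show ?thesis using K(2) z unfolding x_def y_def by auto
    next
      case 2
      then have "prod.swap z \<in> L" using L(2) z unfolding x_def y_def by (auto simp: tile_swap)
      then have "z \<in> prod.swap ` L" by (auto intro: image_eqI[of _ _ "prod.swap z"])
      then show ?thesis by blast
    next
      case 3
      \<comment> \<open>The slope cutoff 16 is the square of 4: in the middle part both coordinates
        stay below \<open>4 * s\<close>, where the boxes end.\<close>
      have "x * x \<le> (4 * s) * (4 * s)"
      proof -
        have "x * x \<le> x * (16 * y)" using 3(1) xy by (intro mult_left_mono) auto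
        also have "\<dots> = 16 * (x * y)" by simp
        also have "\<dots> \<le> 16 * (s * s)" using xy by simp
        finally show ?thesis by simp
      qed
      then have x4: "x \<le> 4 * s" using s xy by (intro power2_le_imp_le[of x "4 * s"]) (simp_all add: power2_eq_square)
      have "y * y \<le> (4 * s) * (4 * s)"
      proof -
        have "y * y \<le> y * (16 * x)" using 3(2) xy by (intro mult_left_mono) auto
        also have "\<dots> = 16 * (x * y)" by simp
        also have "\<dots> \<le> 16 * (s * s)" using xy by simp
        finally show ?thesis by simp
      qed
      then have y4: "y \<le> 4 * s" using s xy by (intro power2_le_imp_le[of y "4 * s"]) (simp_all add: power2_eq_square)
      have s0: "0 < s" using x4 xy by linarith
      have k: "v \<le> s * s / c" if "c \<le> u" "0 < c" "u * v \<le> s * s" "0 < v" for u v c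
      proof -
        have "c * v \<le> s * s" using mult_right_mono[of c u v] that by linarith
        then show ?thesis using that by (simp add: field_simps)
      qed
      have "s < x \<Longrightarrow> y \<le> s" "2 * s < x \<Longrightarrow> y \<le> s / 2" "s < y \<Longrightarrow> x \<le> s" "2 * s < y \<Longrightarrow> x \<le> s / 2"
        using k[of s x y] k[of "2 * s" x y] k[of s y x] k[of "2 * s" y x] s0 xy
        by (auto simp: mult.commute)
      then show ?thesis unfolding Un_iff mem using xy x4 y4 by linarith
    qed
  qed
  have L': "prod.swap ` L \<in> sets borel" "emeasure lborel (prod.swap ` L) = emeasure lborel L"
    using lborel_swap[of L] L(1) by (auto simp: fmeasurable_def)
  then have Lf: "prod.swap ` L \<in> fmeasurable lborel" "measure lborel (prod.swap ` L) = measure lborel L"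
    using L(1) by (auto simp: fmeasurable_def measure_def)
  have "measure lborel (tile B p) \<le> measure lborel (K \<union> prod.swap ` L \<union> ?Q)"
    using tile_borel[OF assms(1)] sub K(1) Lf(1) bs
    by (intro measure_mono_fmeasurable) (auto intro!: fmeasurable.Un)
  also have "\<dots> \<le> measure lborel K + measure lborel (prod.swap ` L) + measure lborel ?Q"
    by (intro order_trans[OF measure_Un_le] add_mono sets.Un bs' order_refl fmeasurableD K Lf)
  also have "\<dots> \<le> (r + measure lborel (skirt B p) / 16) +
      (r + measure lborel (skirt (prod.swap ` B) (prod.swap p)) / 16) + (r + r + r + r + r)"
    using K(3) L(3) Lf(2) \<open>measure lborel ?Q \<le> r + r + r + r + r\<close> by (intro add_mono) simp_all
  finally show ?thesis by (simp add: add_divide_distrib)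
qed

section \<open>The greedy choice dominates the tile\<close>

text \<open>The rectangle from \<open>ps ! i\<close> to \<open>z\<close> competes in the greedy
  choice. Rectangles already placed have interiors inside the quadrants of earlier points, which it
  avoids.\<close>

lemma greedy_area_ge:
  assumes run: "greedy_run S ps D" and i: "i < length ps" and S: "S \<subseteq> unit_sq"
    and z: "z \<in> tile (set (take i ps)) (ps ! i)"
  shows "(fst z - fst (ps ! i)) * (snd z - snd (ps ! i)) \<le> fst (D (ps ! i)) * snd (D (ps ! i))"
proof -
  let ?p = "ps ! i" and ?d = "z - ps ! i"
  let ?P = "{ll_rect (ps ! j) (D (ps ! j)) | j. j < i}"
  have ord: "greedy_order S ps" using run unfolding greedy_run_def by blast
  have p: "?p \<in> unit_sq" using S i ord unfolding greedy_order_def by auto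
  have zp: "fst ?p < fst z" "snd ?p < snd z" "fst z \<le> 1" "snd z \<le> 1"
    using z unfolding tile_def by auto
  have zB: "\<not> (fst (ps ! j) < fst z \<and> snd (ps ! j) < snd z)" if "j < i" for j
  proof -
    have "ps ! j \<in> set (take i ps)" using that i by (auto simp: in_set_take_iff)
    then show ?thesis using z unfolding tile_def by blast
  qed
  have "feasible_rect S ?P ?p ?d"
    unfolding feasible_rect_def
  proof (intro conjI ballI)
    show "0 \<le> fst ?d" "0 \<le> snd ?d" using zp by auto
    show "ll_rect ?p ?d \<subseteq> unit_sq" using p zp unfolding ll_rect_def unit_sq_def by auto
    show "interior (ll_rect ?p ?d) \<inter> interior R = {}" if "R \<in> ?P" for R
      using that zB unfolding interior_ll_rect by (fastforce simp: interior_ll_rect)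
    fix q assume "q \<in> S"
    then obtain j where j: "j < length ps" "q = ps ! j"
      using ord unfolding greedy_order_def by (metis in_set_conv_nth)
    show "q \<notin> interior (ll_rect ?p ?d)"
    proof (cases "j < i")
      case True
      then show ?thesis using zB[of j] j unfolding interior_ll_rect by (auto simp: mem_Times_iff)
    next
      case False
      \<comment> \<open>Neither \<open>ps ! i\<close> nor a later point can lie strictly above and
        to the right of \<open>ps ! i\<close>, since its coordinate sum is not larger.\<close>
      then have "csum q \<le> csum ?p"
        using ord j i unfolding greedy_order_def by (cases "i = j") auto
      then show ?thesis unfolding interior_ll_rect csum_def by (auto simp: mem_Times_iff)
    qed
  qed
  then have "fst ?d * snd ?d \<le> fst (D ?p) * snd (D ?p)"
    using run i unfolding greedy_run_def Let_def by blast
  then show ?thesis by simp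
qed

section \<open>Summation over skirts and tiles\<close>

lemma sum_skirt_le:
  assumes S: "set ps \<subseteq> unit_sq"
    and ord: "\<And>i j. i < j \<Longrightarrow> j < length ps \<Longrightarrow> csum (ps ! j) \<le> csum (ps ! i)"
  shows "(\<Sum>i<length ps. measure lborel (skirt (set (take i ps)) (ps ! i))) \<le> 2"
proof -
  let ?E = "\<lambda>i. skirt (set (take i ps)) (ps ! i)"
  have disj: "?E j \<inter> ?E i = {}" if ij: "i < j" "j < length ps" for i j
  proof (rule skirt_disjoint)
    show "ps ! i \<in> set (take j ps)" using ij by (auto simp: in_set_take_iff)
    fix s assume "s \<in> set (take j ps)" "csum (ps ! i) < csum s"
    then obtain k where k: "k < j" "s = ps ! k" using ij by (auto simp: in_set_take_iff)
    \<comment> \<open>Ties in the order do no harm: a strictly larger coordinate sum forces an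
      earlier index.\<close>
    have "k < i"
      using ord[of i k] k ij \<open>csum (ps ! i) < csum s\<close> by (cases k i rule: linorder_cases) auto
    then show "s \<in> set (take i ps)" using k ij by (auto simp: in_set_take_iff)
  qed
  have "pairwise (\<lambda>i j. disjnt (?E i) (?E j)) {..<length ps}"
    using disj unfolding pairwise_def disjnt_def by (metis Int_commute lessThan_iff linorder_neqE_nat)
  then have "(\<Sum>i<length ps. measure lborel (?E i)) = measure lborel (\<Union>i<length ps. ?E i)"
    by (intro measure_UNION'[symmetric] skirt_fmeasurable) auto
  also have "\<dots> \<le> measure lborel (cbox (0, -1) (1, 1) :: point set)"
  proof (intro measure_mono_fmeasurable fmeasurable_cbox)
    \<comment> \<open>A skirt point has abscissa at most 1 and coordinate sum above
      \<open>csum (ps ! i)\<close>, so its ordinate is at least -1.\<close>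
    show "(\<Union>i<length ps. ?E i) \<subseteq> cbox (0, -1) (1, 1)"
    proof
      fix z assume "z \<in> (\<Union>i<length ps. ?E i)"
      then obtain i where i: "i < length ps" "z \<in> ?E i" by blast
      then have "z \<in> {fst (ps ! i)..1} \<times> {csum (ps ! i) - 1..snd (ps ! i)}" using skirt_subset by blast
      moreover have "ps ! i \<in> unit_sq" using S i by auto
      ultimately show "z \<in> cbox (0, -1) (1, 1)"
        unfolding unit_sq_def csum_def cbox_point by (auto simp: mem_Times_iff)
    qed
  qed (auto intro!: skirt_borel)
  also have "\<dots> = 2" by (simp add: content_Pair)
  finally show ?thesis .
qed

text \<open>A point of the open square lies in the tile of the first listed point whose open
  quadrant contains it; the origin guarantees that there is one.\<close>

lemma sum_tile_ge:
  assumes "(0, 0) \<in> set ps"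
  shows "1 \<le> (\<Sum>i<length ps. measure lborel (tile (set (take i ps)) (ps ! i)))"
proof -
  let ?T = "\<lambda>i. tile (set (take i ps)) (ps ! i)"
  have cover: "box (0, 0) (1, 1) \<subseteq> (\<Union>i<length ps. ?T i)"
  proof
    fix z :: point assume "z \<in> box (0, 0) (1, 1)"
    then have z: "0 < fst z" "fst z < 1" "0 < snd z" "snd z < 1"
      unfolding box_point by (auto simp: mem_Times_iff)
    let ?P = "\<lambda>i. i < length ps \<and> fst (ps ! i) < fst z \<and> snd (ps ! i) < snd z"
    have ex: "\<exists>i. ?P i" using assms z by (metis fst_conv in_set_conv_nth snd_conv)
    then obtain n where n: "?P n" "\<And>j. j < n \<Longrightarrow> \<not> ?P j"
      unfolding exists_least_iff[of ?P] by blast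
    have "\<not> (fst q < fst z \<and> snd q < snd z)" if q: "q \<in> set (take n ps)" for q
    proof -
      obtain j where "j < n" "q = ps ! j" using q n(1) by (auto simp: in_set_take_iff)
      then show ?thesis using n(2)[of j] n(1) by simp
    qed
    then have "z \<in> ?T n" using n(1) z unfolding tile_def by simp
    then show "z \<in> (\<Union>i<length ps. ?T i)" using n(1) by blast
  qed
  have "1 = measure lborel (box (0, 0) (1, 1) :: point set)"
    by (simp add: measure_box_point del: measure_lborel_box)
  also have "\<dots> \<le> measure lborel (\<Union>i<length ps. ?T i)"
  proof (intro measure_mono_fmeasurable cover)
    have "?T i \<in> fmeasurable lborel" for i
    proof (rule fmeasurableI2[OF fmeasurable_cbox])
      show "?T i \<subseteq> cbox (ps ! i) (1, 1)" by (auto simp: tile_def cbox_point)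
    qed (simp add: tile_borel)
    then show "(\<Union>i<length ps. ?T i) \<in> fmeasurable lborel" by (blast intro: fmeasurable.finite_UN)
  qed auto
  also have "\<dots> \<le> (\<Sum>i<length ps. measure lborel (?T i))"
    by (rule measure_UNION_le) (simp_all add: tile_borel)
  finally show ?thesis .
qed

section \<open>Existence of a greedy run\<close>

text \<open>Keeping a given point out of the interior is a closed condition on the side lengths. The
  feasible side lengths thus form a compact set, which contains the degenerate choice 0, and the
  area attains its maximum there.\<close>

lemma feasible_rect_max_exists:
  assumes p: "p \<in> unit_sq"
  shows "\<exists>d. feasible_rect S P p d \<and>
    (\<forall>d'. feasible_rect S P p d' \<longrightarrow> fst d' * snd d' \<le> fst d * snd d)"
proof -
  let ?F = "{d. feasible_rect S P p d}"
  let ?G = "\<lambda>w. {d. w \<notin> interior (ll_rect p d)}"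
  have G: "closed (?G w)" for w
  proof -
    have "?G w = {d. fst w \<le> fst p \<or> fst p + fst d \<le> fst w \<or> snd w \<le> snd p \<or> snd p + snd d \<le> snd w}"
      unfolding interior_ll_rect by (auto simp: mem_Times_iff)
    then show ?thesis
      by (simp only:) (intro closed_Collect_disj closed_Collect_le continuous_intros)
  qed
  have eq: "?F = ({0..1 - fst p} \<times> {0..1 - snd p}) \<inter>
      ((\<Inter>w\<in>(\<Union>R\<in>P. interior R) \<union> S. ?G w))"
    using p unfolding feasible_rect_def unit_sq_def ll_rect_def
    by (auto simp: times_subset_iff)
  have "compact ?F"
    unfolding eq by (intro compact_Int_closed compact_Times compact_Icc closed_INT ballI G)
  moreover have "0 \<in> ?F"
    using p unfolding eq unit_sq_def by (auto simp: interior_ll_rect mem_Times_iff)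
  moreover have "continuous_on ?F (\<lambda>d. fst d * snd d)" by (intro continuous_intros)
  ultimately show ?thesis using continuous_attains_sup[of ?F "\<lambda>d. fst d * snd d"] by blast
qed

lemma greedy_order_exists:
  assumes "finite S"
  shows "\<exists>ps. greedy_order S ps"
proof -
  obtain xs where xs: "set xs = S" "distinct xs" using finite_distinct_list[OF assms] by blast
  let ?ps = "sort_key (\<lambda>p. - csum p) xs"
  have "sorted (map (\<lambda>p. - csum p) ?ps)" by simp
  then have "csum (?ps ! j) \<le> csum (?ps ! i)" if "i < j" "j < length ?ps" for i j
    using sorted_nth_mono[of "map (\<lambda>p. - csum p) ?ps" i j] that by simp
  then show ?thesis using xs unfolding greedy_order_def by (intro exI[of _ ?ps]) auto
qed

lemma greedy_run_exists:
  assumes "finite S" "S \<subseteq> unit_sq"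
  shows "\<exists>ps D. greedy_run S ps D"
proof -
  obtain ps where ps: "greedy_order S ps" using greedy_order_exists[OF assms(1)] by blast
  define P where "P = (\<lambda>D i. {ll_rect (ps ! j) (D (ps ! j)) | j. j < i})"
  define Q where "Q = (\<lambda>D i. feasible_rect S (P D i) (ps ! i) (D (ps ! i)) \<and>
    (\<forall>d. feasible_rect S (P D i) (ps ! i) d \<longrightarrow>
       fst d * snd d \<le> fst (D (ps ! i)) * snd (D (ps ! i))))"
  have "\<exists>D. \<forall>i<n. Q D i" if "n \<le> length ps" for n
    using that
  proof (induction n)
    case (Suc n)
    then obtain D where D: "\<forall>i<n. Q D i" by auto
    have "ps ! n \<in> unit_sq" using Suc.prems ps assms(2) unfolding greedy_order_def by auto
    then obtain d where d: "feasible_rect S (P D n) (ps ! n) d"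
      "\<forall>d'. feasible_rect S (P D n) (ps ! n) d' \<longrightarrow> fst d' * snd d' \<le> fst d * snd d"
      using feasible_rect_max_exists by blast
    let ?D = "D(ps ! n := d)"
    \<comment> \<open>Distinctness of the list ensures that the update at \<open>ps ! n\<close>
      leaves all earlier choices unchanged.\<close>
    have ne: "ps ! j \<noteq> ps ! n" if "j < n" for j
      using ps that Suc.prems unfolding greedy_order_def by (simp add: nth_eq_iff_index_eq)
    have P: "P ?D i = P D i" if "i \<le> n" for i
      unfolding P_def using ne that by (intro Collect_cong ex_cong1) auto
    have "Q ?D i" if "i < Suc n" for i
    proof (cases "i = n")
      case True
      then show ?thesis using d unfolding Q_def by (simp add: P)
    next
      case False
      then have "i < n" using that by simp
      then show ?thesis using D ne unfolding Q_def by (simp add: P)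
    qed
    then show ?case by blast
  qed simp
  then obtain D where "\<forall>i<length ps. Q D i" by blast
  then have "greedy_run S ps D" using ps unfolding greedy_run_def Q_def P_def Let_def by blast
  then show ?thesis by blast
qed

section \<open>Packing property and total area\<close>

lemma greedy_run_is_LLARP:
  assumes "greedy_run S ps D"
  shows "is_LLARP S D"
proof -
  let ?R = "\<lambda>i. ll_rect (ps ! i) (D (ps ! i))"
  have S: "set ps = S" using assms unfolding greedy_run_def greedy_order_def by blast
  have f: "feasible_rect S {?R j | j. j < i} (ps ! i) (D (ps ! i))" if "i < length ps" for i
    using assms that unfolding greedy_run_def Let_def by blast
  have disj: "interior (?R i) \<inter> interior (?R j) = {}" if "j < i" "i < length ps" for i j
    using f[OF that(2)] that(1) unfolding feasible_rect_def by blast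
  show ?thesis
    unfolding is_LLARP_def
  proof (rule conjI; intro ballI impI)
    fix p assume "p \<in> S"
    then obtain i where i: "i < length ps" "p = ps ! i" using S by (metis in_set_conv_nth)
    then show "0 \<le> fst (D p) \<and> 0 \<le> snd (D p) \<and> ll_rect p (D p) \<subseteq> unit_sq \<and>
        (\<forall>q\<in>S. q \<notin> interior (ll_rect p (D p)))"
      using f[of i] unfolding feasible_rect_def by blast
    fix q assume "q \<in> S" "p \<noteq> q"
    then obtain j where j: "j < length ps" "q = ps ! j" using S by (metis in_set_conv_nth)
    show "interior (ll_rect p (D p)) \<inter> interior (ll_rect q (D q)) = {}"
      using disj[of i j] disj[of j i] i j \<open>p \<noteq> q\<close> by (cases i j rule: linorder_cases) auto
  qed
qed

text \<open>The interiors are disjoint, so their areas add up exactly; passing to the closed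
  rectangles can only enlarge the union.\<close>

lemma LLARP_packing_area:
  assumes "finite S" "is_LLARP S D"
  shows "(\<Sum>p\<in>S. fst (D p) * snd (D p)) \<le> packing_area S D"
proof -
  let ?I = "\<lambda>p. box p (p + D p)"
  have I: "interior (ll_rect p (D p)) = ?I p" for p
    by (simp add: interior_ll_rect box_point)
  have R: "ll_rect p (D p) = cbox p (p + D p)" for p
    by (simp add: ll_rect_def cbox_point)
  have nn: "0 \<le> fst (D p)" "0 \<le> snd (D p)" if "p \<in> S" for p
    using assms(2) that unfolding is_LLARP_def by auto
  have "measure lborel (?I p) = fst (D p) * snd (D p)" if "p \<in> S" for p
    using nn[OF that] by (simp add: measure_box_point del: measure_lborel_box)
  then have "(\<Sum>p\<in>S. fst (D p) * snd (D p)) = (\<Sum>p\<in>S. measure lborel (?I p))" by simp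
  also have "\<dots> = measure lborel (\<Union>p\<in>S. ?I p)"
    using assms unfolding is_LLARP_def I
    by (intro measure_UNION'[symmetric]) (auto simp: pairwise_def disjnt_def fmeasurable_box)
  also have "\<dots> \<le> packing_area S D"
    unfolding packing_area_def R
  proof (rule measure_mono_fmeasurable)
    show "(\<Union>p\<in>S. ?I p) \<subseteq> (\<Union>p\<in>S. cbox p (p + D p))" using box_subset_cbox by blast
  qed (use assms(1) in \<open>auto intro!: fmeasurable.finite_UN sets.finite_UN simp: fmeasurable_cbox\<close>)
  finally show ?thesis .
qed

lemma greedy_packing_area_ge:
  assumes "finite S" "S \<subseteq> unit_sq" "(0, 0) \<in> S" and run: "greedy_run S ps D"
  shows "3 / 28 \<le> packing_area S D"
proof -
  have ord: "distinct ps" "set ps = S"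
    "\<And>i j. i < j \<Longrightarrow> j < length ps \<Longrightarrow> csum (ps ! j) \<le> csum (ps ! i)"
    using run unfolding greedy_run_def greedy_order_def by auto
  have LL: "is_LLARP S D" by (rule greedy_run_is_LLARP[OF run])
  let ?B = "\<lambda>i. set (take i ps)"
  let ?r = "\<lambda>i. fst (D (ps ! i)) * snd (D (ps ! i))"
  let ?E = "\<lambda>i. measure lborel (skirt (?B i) (ps ! i))"
  let ?F = "\<lambda>i. measure lborel (skirt (prod.swap ` ?B i) (prod.swap (ps ! i)))"
  have E: "(\<Sum>i<length ps. ?E i) \<le> 2"
    using sum_skirt_le[of ps] ord assms(2) by auto
  \<comment> \<open>Reflection in the diagonal preserves coordinate sums, so the reflected list is
    again ordered and the bound on skirts applies to it.\<close>
  have F: "(\<Sum>i<length ps. ?F i) \<le> 2"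
  proof -
    have "set (map prod.swap ps) \<subseteq> unit_sq"
      using ord(2) assms(2) unfolding unit_sq_def by auto
    moreover have "csum (map prod.swap ps ! j) \<le> csum (map prod.swap ps ! i)"
      if "i < j" "j < length (map prod.swap ps)" for i j
      using ord(3)[of i j] that unfolding csum_def by simp
    ultimately have "(\<Sum>i<length (map prod.swap ps).
        measure lborel (skirt (set (take i (map prod.swap ps))) (map prod.swap ps ! i))) \<le> 2"
      by (rule sum_skirt_le)
    then show ?thesis by (simp add: take_map)
  qed
  have "1 \<le> (\<Sum>i<length ps. measure lborel (tile (?B i) (ps ! i)))"
    using sum_tile_ge assms(3) ord(2) by blast
  also have "\<dots> \<le> (\<Sum>i<length ps. 7 * ?r i + (?E i + ?F i) / 16)"
  proof (rule sum_mono)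
    fix i assume "i \<in> {..<length ps}"
    then have i: "i < length ps" by simp
    have "0 \<le> ?r i" using LL i ord(2) nth_mem unfolding is_LLARP_def by (intro mult_nonneg_nonneg) blast+
    then show "measure lborel (tile (?B i) (ps ! i)) \<le> 7 * ?r i + (?E i + ?F i) / 16"
      using greedy_area_ge[OF run i assms(2)] by (intro measure_tile_le) auto
  qed
  also have "\<dots> = 7 * (\<Sum>i<length ps. ?r i) + ((\<Sum>i<length ps. ?E i) + (\<Sum>i<length ps. ?F i)) / 16"
    by (simp add: sum.distrib sum_distrib_left flip: sum_divide_distrib)
  also have "(\<Sum>i<length ps. ?r i) = (\<Sum>p\<in>S. fst (D p) * snd (D p))"
    by (rule sum.reindex_bij_betw[OF bij_betw_nth]) (use ord in auto)
  finally have "1 \<le> 7 * (\<Sum>p\<in>S. fst (D p) * snd (D p)) +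
      ((\<Sum>i<length ps. ?E i) + (\<Sum>i<length ps. ?F i)) / 16" .
  \<comment> \<open>The constant is \<open>(1 - 4 / 16) / 7\<close>.\<close>
  moreover have "3 / 28 \<le> P" if "1 \<le> 7 * R + (e + f) / 16" "e \<le> 2" "f \<le> 2" "R \<le> P"
    for P R e f :: real
    using that by (simp add: field_simps)
  ultimately show ?thesis using E F LLARP_packing_area[OF assms(1) LL] by blast
qed

theorem theorem8:
  fixes S :: "(real \<times> real) set"
  assumes "finite S" and "S \<subseteq> unit_sq" and "(0, 0) \<in> S"
  shows "(\<exists>ps D. greedy_run S ps D) \<and>
         (\<forall>ps D. greedy_run S ps D \<longrightarrow> is_LLARP S D \<and> packing_area S D \<ge> 0.10390)"
proof (intro conjI allI impI)
  show "\<exists>ps D. greedy_run S ps D" by (rule greedy_run_exists[OF assms(1,2)])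
  fix ps D assume run: "greedy_run S ps D"
  show "is_LLARP S D" by (rule greedy_run_is_LLARP[OF run])
  show "packing_area S D \<ge> 0.10390" using greedy_packing_area_ge[OF assms run] by simp
qed

end
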